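(* Let $q>2$ be a prime power, let $\bm a\in\mathbb F_{q^2}^n$ have distinct entries, $\bm v\in(\mathbb F_{q^2}^* )^n$, $1\le k\le n$, and let $\mathcal C=GRS_k(\bm a,\bm v)$ be the $[n,k]_{q^2}$ GRS code with generator matrix $G=G_k(\bm a,\bm v)$ and with $l$-dimensional Hermitian hull, $0\le l\le k$. Let $\bm w$ be either $\bm w=\bm g_k$, or, in the case $n<q^2$ and $\bm a\in(\mathbb F_{q^2}^* )^n$, $\bm w=\bm g_{-1}$. Then the following hold. (1) If $\bm w\in\mathcal C^{\perp_H}$ and $\bm w\bm w^\dagger\neq0$, then for each $0\le s\le l+1$ there exists an $[n+1,k+1]_{q^2}$ MDS code with $s$-dimensional Hermitian hull. (2) If $\bm w\notin(\mathrm{Hull}_H(\mathcal C))^{\perp_H}$, then for each $0\le s\le l-1$ there exists an $[n+1,k+1]_{q^2}$ MDS code with $s$-dimensional Hermitian hull. (3) If $\bm w\in(\mathrm{Hull}_H(\mathcal C))^{\perp_H}$, then for each $0\le s\le l$ there exists an $[n+1,k+1]_{q^2}$ MDS code with $s$-dimensional Hermitian hull. (4) For every $\lambda\in\mathbb F_q^*$ with $\lambda+\bm w\bm w^\dagger\ne0$, setting $S=(\lambda+\bm w\bm w^\dagger)E_n-\bm w^\dagger\bm w$, for each $0\le s\le k-\mathrm{rank}(GSG^\dagger)$ there exists an $[n+1,k+1]_{q^2}$ MDS code with $s$-dimensional Hermitian hull.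
   Context: For a matrix $A=(a_{ij})$ over $\mathbb F_{q^2}$ (row vectors included), $A^\dagger=(a_{ji}^q)$; $E_n$ is the $n\times n$ identity matrix. For a linear code $\mathcal C\subseteq\mathbb F_{q^2}^n$, $\mathcal C^{\perp_H}=\{\bm x:\sum_i y_ix_i^q=0\ \text{for all }\bm y\in\mathcal C\}$ and $\mathrm{Hull}_H(\mathcal C)=\mathcal C\cap\mathcal C^{\perp_H}$. For $\bm a$ with distinct entries and $\bm v\in(\mathbb F_{q^2}^* )^n$, the GRS code is $GRS_k(\bm a,\bm v)=\{(v_1f(a_1),\dots,v_nf(a_n)):f\in\mathbb F_{q^2}[x],\deg f\le k-1\}$, $1\le k\le n$. For an integer $i$, $\bm g_i$ is the row vector $(v_1a_1^i,\dots,v_na_n^i)$ (with $0^0=1$; for $i=-1$ all $a_j$ must be nonzero), and $G_k(\bm a,\bm v)$ is the generator matrix with rows $\bm g_0,\dots,\bm g_{k-1}$. An $[n,k]$ linear code is MDS if its minimum distance is $n-k+1$. *)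

theory Defs
  imports
    "Jordan_Normal_Form.DL_Rank"
    "HOL-Number_Theory.Prime_Powers"
begin

text \<open>
  The field with \<open>q\<^sup>2\<close> elements is a finite field type \<open>'a\<close> of that cardinality. The parameter
  \<open>q\<close> enters the definitions below through the conjugation \<open>x \<mapsto> x ^ q\<close>.
  Words of length \<open>n\<close> are elements of \<^term>\<open>carrier_vec n\<close>, codes are sets of words.
\<close>

text \<open>The subfield with \<open>q\<close> elements, as the fixed field of the conjugation.\<close>

definition Fq :: "nat \<Rightarrow> 'a :: field set" where
  "Fq q = {x. x ^ q = x}"

definition dagger :: "nat \<Rightarrow> 'a :: field mat \<Rightarrow> 'a mat" where
  "dagger q A = mat (dim_col A) (dim_row A) (\<lambda>(i, j). (A $$ (j, i)) ^ q)"

definition linear_code :: "nat \<Rightarrow> 'a :: field vec set \<Rightarrow> bool" where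
  "linear_code n C \<longleftrightarrow> VectorSpace.subspace class_ring C (module_vec TYPE('a) n)"

definition code_dim :: "nat \<Rightarrow> 'a :: field vec set \<Rightarrow> nat" where
  "code_dim n C = vectorspace.dim class_ring ((module_vec TYPE('a) n)\<lparr>carrier := C\<rparr>)"

definition hamming_dist :: "'a vec \<Rightarrow> 'a vec \<Rightarrow> nat" where
  "hamming_dist x y = card {i. i < dim_vec x \<and> x $ i \<noteq> y $ i}"

definition min_dist :: "'a vec set \<Rightarrow> nat" where
  "min_dist C = Min {hamming_dist x y | x y. x \<in> C \<and> y \<in> C \<and> x \<noteq> y}"

definition mds_code :: "nat \<Rightarrow> nat \<Rightarrow> 'a :: field vec set \<Rightarrow> bool" where
  "mds_code n k C \<longleftrightarrow> linear_code n C \<and> code_dim n C = k \<and> min_dist C = n - k + 1"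

definition herm_dual :: "nat \<Rightarrow> nat \<Rightarrow> 'a :: field vec set \<Rightarrow> 'a vec set" where
  "herm_dual q n C = {x \<in> carrier_vec n. \<forall>y\<in>C. (\<Sum>i<n. y $ i * (x $ i) ^ q) = 0}"

definition herm_hull :: "nat \<Rightarrow> nat \<Rightarrow> 'a :: field vec set \<Rightarrow> 'a vec set" where
  "herm_hull q n C = C \<inter> herm_dual q n C"

text \<open>For \<open>k \<ge> 1\<close>, the condition \<open>degree f \<le> k - 1\<close> also admits the zero polynomial,
  whose degree is \<open>0\<close>.\<close>

definition GRS :: "nat \<Rightarrow> nat \<Rightarrow> 'a :: field vec \<Rightarrow> 'a vec \<Rightarrow> 'a vec set" where
  "GRS n k a v = {vec n (\<lambda>j. v $ j * poly f (a $ j)) | f. degree f \<le> k - 1}"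

text \<open>Here \<open>0 powi 0 = 1\<close>. For \<open>i < 0\<close> the definition is meaningful only if all
  entries of \<open>a\<close> are nonzero.\<close>

definition grs_row :: "nat \<Rightarrow> 'a :: field vec \<Rightarrow> 'a vec \<Rightarrow> int \<Rightarrow> 'a vec" where
  "grs_row n a v i = vec n (\<lambda>j. v $ j * (a $ j) powi i)"

definition grs_gen_mat :: "nat \<Rightarrow> nat \<Rightarrow> 'a :: field vec \<Rightarrow> 'a vec \<Rightarrow> 'a mat" where
  "grs_gen_mat n k a v = mat_of_rows n (map (\<lambda>i. grs_row n a v (int i)) [0..<k])"

text \<open>The scalar \<open>w w\<^sup>\<dagger>\<close> is the single entry of a \<open>1 \<times> 1\<close> matrix.\<close>

definition herm_norm :: "nat \<Rightarrow> 'a :: field vec \<Rightarrow> 'a" where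
  "herm_norm q w = (mat_of_row w * dagger q (mat_of_row w)) $$ (0, 0)"

end

theory Submission
  imports Defs "Jordan_Normal_Form.Matrix_Kernel" "HOL-Number_Theory.Residues"
begin

text \<open>
  Extend the code to the words \<open>(c + t w, t \<alpha>)\<close> with a suitable \<open>\<alpha> \<noteq> 0\<close>. This adds to the
  evaluation points either the point at infinity (\<open>w = g\<^sub>k\<close>) or the point \<open>0\<close> (\<open>w = g\<^bsub>-1\<^esub>\<close>), so the
  extended code is MDS. Its hull is controlled by \<open>\<alpha>\<^bsup>q+1\<^esup>\<close>, which can be any element of
  \<open>F\<^sub>q\<^sup>*\<close> as the norm is surjective: take \<open>- w w\<^sup>\<dagger>\<close> in (1), \<open>1\<close> in (2) and (3), and \<open>\<lambda>\<close> in (4), where the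
  kernel of \<open>G S G\<^sup>\<dagger>\<close> embeds into the hull. Finally the hull dimension of an MDS code can be
  lowered by exactly one: multiplying a coordinate \<open>i\<close> in the support of the hull by \<open>b\<close> with
  \<open>b\<^bsup>q+1\<^esup> \<noteq> 1\<close>, which exists for \<open>q > 2\<close>, shrinks the hull to its vectors vanishing at \<open>i\<close>.
  Dimensions are compared through cardinalities.
\<close>

section \<open>Cardinalities of linear codes\<close>

lemma linear_code_iff:
  fixes C :: "'a :: field vec set"
  shows "linear_code n C \<longleftrightarrow> C \<subseteq> carrier_vec n \<and> 0\<^sub>v n \<in> C \<and>
    (\<forall>x\<in>C. \<forall>y\<in>C. x + y \<in> C) \<and> (\<forall>c. \<forall>x\<in>C. c \<cdot>\<^sub>v x \<in> C)"
proof -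
  interpret V: vec_space "TYPE('a)" n .
  show ?thesis
    unfolding linear_code_def VectorSpace.subspace_def LinearCombinations.submodule_def
    using V.vectorspace_axioms V.module_axioms
    by (auto simp: module_vec_simps)
qed

lemma linear_code_finite:
  fixes C :: "'a :: {field, finite} vec set"
  assumes "linear_code n C"
  shows "finite C"
proof -
  have "carrier_vec n \<subseteq> vec_of_list ` {xs :: 'a list. set xs \<subseteq> UNIV \<and> length xs = n}"
    by (auto intro!: image_eqI[of _ vec_of_list "list_of_vec _"] simp: vec_list)
  then have "finite (carrier_vec n :: 'a vec set)"
    using finite_lists_length_eq[OF finite_UNIV, of n] by (rule finite_subset[OF _ finite_imageI])
  then show ?thesis
    using assms finite_subset by (auto simp: linear_code_iff)
qed

lemma linear_code_diff:
  fixes C :: "'a :: field vec set"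
  assumes "linear_code n C" "x \<in> C" "y \<in> C"
  shows "x - y \<in> C"
proof -
  have c: "x \<in> carrier_vec n" "y \<in> carrier_vec n"
    using assms by (auto simp: linear_code_iff)
  have "x + (- 1) \<cdot>\<^sub>v y \<in> C"
    using assms by (auto simp: linear_code_iff)
  also have "x + (- 1) \<cdot>\<^sub>v y = x - y"
    using c by auto
  finally show ?thesis .
qed

text \<open>Coordinates with respect to a basis identify the code with the functions from the basis
  to the field. As the field has at least two elements, dimensions can then be compared by counting
  words.\<close>

lemma card_linear_code:
  fixes C :: "'a :: {field, finite} vec set"
  assumes C: "linear_code n C"
  shows "card C = card (UNIV :: 'a set) ^ code_dim n C"
proof -
  interpret V: vec_space "TYPE('a)" n .
  interpret W: vectorspace "class_ring :: 'a ring" "V.vs C"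
    using C unfolding linear_code_def by (rule V.subspace_is_vs)
  have carr: "carrier (V.vs C) = C" "carrier (class_ring :: 'a ring) = UNIV"
    by simp_all
  \<comment> \<open>Being finite, the code is a finite spanning set of itself, which supplies a
    finite basis.\<close>
  have "finite C" by (rule linear_code_finite[OF C])
  moreover have "C \<subseteq> W.span C"
    using W.in_own_span[of C] by simp
  moreover have "W.span C \<subseteq> C"
    using W.span_is_subset2[of C] by simp
  ultimately have "W.fin_dim"
    unfolding W.fin_dim_def carr by blast
  then obtain B where B: "finite B" "W.basis B"
    using W.finite_basis_exists by blast
  have BC: "B \<subseteq> carrier (V.vs C)"
    using B(2) W.basis_def by blast
  have uniq: "\<And>v. v \<in> C \<Longrightarrow> \<exists>!a. a \<in> B \<rightarrow>\<^sub>E UNIV \<and> W.lincomb a B = v"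
    using W.basis_criterion[OF B(1) BC] B(2) unfolding carr by blast
  have "bij_betw (\<lambda>a. W.lincomb a B) (B \<rightarrow>\<^sub>E (UNIV :: 'a set)) C"
  proof (rule bij_betw_imageI)
    have mem: "W.lincomb a B \<in> C" for a
      using W.lincomb_closed[OF BC, of a] unfolding carr by simp
    show "inj_on (\<lambda>a. W.lincomb a B) (B \<rightarrow>\<^sub>E UNIV)"
      by (rule inj_onI) (metis mem uniq)
    show "(\<lambda>a. W.lincomb a B) ` (B \<rightarrow>\<^sub>E UNIV) = C"
      using mem uniq by (auto simp: image_iff) metis
  qed
  then have "card C = card (B \<rightarrow>\<^sub>E (UNIV :: 'a set))"
    by (simp add: bij_betw_same_card)
  also have "\<dots> = card (UNIV :: 'a set) ^ card B"
    using B(1) by (simp add: card_funcsetE)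
  also have "card B = code_dim n C"
    unfolding code_dim_def by (rule W.dim_basis[OF B, symmetric])
  finally show ?thesis .
qed

text \<open>The nonempty fibres of \<open>f\<close> are the translates of \<open>K\<close>. Phrasing
  the hypothesis through differences leaves the target of \<open>f\<close> arbitrary, so scalar
  functionals and matrix maps are both covered.\<close>

lemma card_eq_card_image_times_card_kernel:
  fixes W :: "'a :: {field, finite} vec set"
  assumes W: "linear_code n W" and K: "K \<subseteq> W"
    and f: "\<And>x y. x \<in> W \<Longrightarrow> y \<in> W \<Longrightarrow> f x = f y \<longleftrightarrow> x - y \<in> K"
  shows "card W = card (f ` W) * card K"
proof -
  have fin: "finite W" by (rule linear_code_finite[OF W])
  have carr: "x \<in> carrier_vec n" if "x \<in> W" for x
    using W that by (auto simp: linear_code_iff)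
  have fibre: "card {y \<in> W. f y = f x} = card K" if x: "x \<in> W" for x
  proof -
    have "{y \<in> W. f y = f x} = (\<lambda>z. z + x) ` K"
    proof (intro equalityI subsetI)
      fix y assume y: "y \<in> {y \<in> W. f y = f x}"
      have "y = (y - x) + x"
        using carr[OF x] carr[of y] y by auto
      then show "y \<in> (\<lambda>z. z + x) ` K"
        using f[of y x] x y by blast
    next
      fix y assume "y \<in> (\<lambda>z. z + x) ` K"
      then obtain z where z: "z \<in> K" "y = z + x" by blast
      have "z \<in> carrier_vec n" using z K carr by blast
      then have "y \<in> W" "y - x = z"
        using W K x carr[OF x] z by (auto simp: linear_code_iff intro!: eq_vecI)
      then show "y \<in> {y \<in> W. f y = f x}"
        using f[of y x] x z by auto
    qed
    moreover have "inj_on (\<lambda>z. z + x) K"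
    proof (rule inj_onI)
      fix y z assume *: "y \<in> K" "z \<in> K" "y + x = z + x"
      have "y = (y + x) - x" "z = (z + x) - x"
        using carr[OF x] carr[of y] carr[of z] *(1,2) K by (auto intro!: eq_vecI)
      with * show "y = z" by simp
    qed
    ultimately show ?thesis by (simp add: card_image)
  qed
  have "card W = (\<Sum>x\<in>W. 1)" by simp
  also have "\<dots> = (\<Sum>y\<in>f ` W. \<Sum>x\<in>{x \<in> W. f x = y}. 1)"
    by (rule sum.image_gen[OF fin])
  also have "\<dots> = (\<Sum>y\<in>f ` W. card K)"
    by (rule sum.cong) (use fibre in auto)
  finally show ?thesis by simp
qed

section \<open>Counting in the full space and in kernels\<close>

lemma card_field_ge_2: "2 \<le> card (UNIV :: 'a :: {field, finite} set)"
proof -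
  have "card {0, 1 :: 'a} \<le> card (UNIV :: 'a set)"
    by (rule card_mono) auto
  then show ?thesis by simp
qed

lemma linear_code_carrier_vec: "linear_code n (carrier_vec n :: 'a :: field vec set)"
  by (auto simp: linear_code_iff)

lemma card_carrier_vec: "card (carrier_vec n :: 'a :: {field, finite} vec set) = card (UNIV :: 'a set) ^ n"
proof -
  interpret V: vec_space "TYPE('a)" n .
  have "code_dim n (carrier_vec n :: 'a vec set) = V.dim"
    unfolding code_dim_def by (rule arg_cong[of _ _ "vectorspace.dim class_ring"]) (simp add: module_vec_def)
  then show ?thesis
    using card_linear_code[OF linear_code_carrier_vec[where 'a = 'a], of n] V.dim_is_n by simp
qed

lemma card_ge_power_code_dim_iff:
  fixes C :: "'a :: {field, finite} vec set"
  assumes "linear_code n C"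
  shows "card (UNIV :: 'a set) ^ s \<le> card C \<longleftrightarrow> s \<le> code_dim n C"
  using card_field_ge_2[where 'a = 'a] by (simp add: card_linear_code[OF assms])

text \<open>The image has at most as many elements as the field, so a kernel has codimension at most
  one. The inequality includes the case of a functional vanishing on \<open>W\<close>.\<close>

lemma card_linear_functional_kernel:
  fixes W :: "'a :: {field, finite} vec set"
  assumes W: "linear_code n W"
    and f: "\<And>x y. x \<in> W \<Longrightarrow> y \<in> W \<Longrightarrow> f (x - y) = f x - (f y :: 'a)"
  shows "card W \<le> card (UNIV :: 'a set) * card {x \<in> W. f x = 0}"
proof -
  have "card W = card (f ` W) * card {x \<in> W. f x = 0}"
    by (rule card_eq_card_image_times_card_kernel[OF W])
       (use f linear_code_diff[OF W] in auto)
  also have "card (f ` W) \<le> card (UNIV :: 'a set)"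
    by (rule card_mono) auto
  finally show ?thesis by simp
qed

text \<open>Rank-nullity in multiplicative form: the image of \<open>M\<close> is its column space,
  whose dimension is the rank.\<close>

lemma card_mat_kernel:
  fixes M :: "'a :: {field, finite} mat"
  assumes M: "M \<in> carrier_mat n k"
  shows "card (UNIV :: 'a set) ^ k = card (UNIV :: 'a set) ^ vec_space.rank n M * card (mat_kernel M)"
proof -
  interpret V: vec_space "TYPE('a)" n .
  have cols: "set (cols M) \<subseteq> carrier_vec n"
    using M cols_dim by blast
  have "linear_code n (V.span (set (cols M)))"
    unfolding linear_code_def using V.span_is_subspace cols by simp
  then have r: "card (V.span (set (cols M))) = card (UNIV :: 'a set) ^ V.rank M"
    by (simp add: card_linear_code code_dim_def V.rank_def)
  have img: "V.span (set (cols M)) = (\<lambda>x. M *\<^sub>v x) ` carrier_vec k"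
    using V.col_space_eq[OF M] M by (auto simp: V.col_space_def)
  have "card (carrier_vec k :: 'a vec set) = card ((\<lambda>x. M *\<^sub>v x) ` carrier_vec k) * card (mat_kernel M)"
  proof (rule card_eq_card_image_times_card_kernel[where W = "carrier_vec k" and K = "mat_kernel M" and f = "(*\<^sub>v) M", OF linear_code_carrier_vec])
    show "mat_kernel M \<subseteq> carrier_vec k"
      using mat_kernelD[OF M] by auto
    fix x y :: "'a vec" assume xy: "x \<in> carrier_vec k" "y \<in> carrier_vec k"
    have e: "M *\<^sub>v (x - y) = M *\<^sub>v x - M *\<^sub>v y"
      using M xy by (simp add: mult_minus_distrib_mat_vec)
    have "M *\<^sub>v x \<in> carrier_vec n" "M *\<^sub>v y \<in> carrier_vec n"
      using M xy by auto
    then have "M *\<^sub>v x = M *\<^sub>v y \<longleftrightarrow> M *\<^sub>v x - M *\<^sub>v y = 0\<^sub>v n"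
      using M by (auto simp: vec_eq_iff)
    then show "M *\<^sub>v x = M *\<^sub>v y \<longleftrightarrow> x - y \<in> mat_kernel M"
      using M xy e by (auto simp: mat_kernel)
  qed
  then show ?thesis
    by (simp add: card_carrier_vec r img[symmetric])
qed

section \<open>MDS codes\<close>

lemma hamming_dist_eq:
  fixes x y :: "'a :: field vec"
  assumes "x \<in> carrier_vec n" "y \<in> carrier_vec n"
  shows "hamming_dist x y = n - card {i. i < n \<and> (x - y) $ i = 0}"
proof -
  have "{i. i < n \<and> x $ i \<noteq> y $ i} = {..<n} - {i. i < n \<and> (x - y) $ i = 0}"
    using assms by auto
  moreover have "card ({..<n} - {i. i < n \<and> (x - y) $ i = 0}) = n - card {i. i < n \<and> (x - y) $ i = 0}"
    by (subst card_Diff_subset) auto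
  ultimately show ?thesis
    using assms by (simp add: hamming_dist_def)
qed

lemma finite_hamming_dists:
  fixes C :: "'a :: {field, finite} vec set"
  assumes "linear_code n C"
  shows "finite {hamming_dist x y | x y. x \<in> C \<and> y \<in> C \<and> x \<noteq> y}"
proof -
  have "{hamming_dist x y | x y. x \<in> C \<and> y \<in> C \<and> x \<noteq> y} \<subseteq> (\<lambda>(x, y). hamming_dist x y) ` (C \<times> C)"
    by auto
  then show ?thesis
    using linear_code_finite[OF assms] by (meson finite_SigmaI finite_imageI finite_subset)
qed

text \<open>Differences of codewords are codewords, so the bound on zeros bounds all distances from
  below. The cardinality makes the projection to \<open>k - 1\<close> positions non-injective, and a
  collision there attains the bound.\<close>

lemma mds_codeI:
  fixes C :: "'a :: {field, finite} vec set"
  assumes C: "linear_code n C" and card: "card C = card (UNIV :: 'a set) ^ k"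
    and k: "1 \<le> k" "k \<le> n"
    and zeros: "\<And>x. x \<in> C \<Longrightarrow> x \<noteq> 0\<^sub>v n \<Longrightarrow> card {i. i < n \<and> x $ i = 0} \<le> k - 1"
  shows "mds_code n k C"
proof -
  let ?D = "{hamming_dist x y | x y. x \<in> C \<and> y \<in> C \<and> x \<noteq> y}"
  have carr: "x \<in> carrier_vec n" if "x \<in> C" for x
    using C that by (auto simp: linear_code_iff)
  have zeros': "card {i. i < n \<and> (x - y) $ i = 0} \<le> k - 1" if "x \<in> C" "y \<in> C" "x \<noteq> y" for x y
  proof (rule zeros)
    show "x - y \<in> C" using linear_code_diff[OF C] that by blast
    show "x - y \<noteq> 0\<^sub>v n"
      using carr[OF that(1)] carr[OF that(2)] that(3) by (auto simp: vec_eq_iff)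
  qed
  have dim: "code_dim n C = k"
    using card_linear_code[OF C] card card_field_ge_2[where 'a = 'a] by simp
  have lower: "n - k + 1 \<le> d" if "d \<in> ?D" for d
  proof -
    obtain x y where xy: "x \<in> C" "y \<in> C" "x \<noteq> y" "d = hamming_dist x y"
      using \<open>d \<in> ?D\<close> by blast
    then show ?thesis
      using zeros'[OF xy(1-3)] hamming_dist_eq[OF carr carr, OF xy(1,2)] k by linarith
  qed
  \<comment> \<open>Singleton bound: two codewords agree on the first \<open>k - 1\<close> positions.\<close>
  have "\<not> inj_on (\<lambda>x. vec (k - 1) (\<lambda>i. x $ i)) C"
  proof
    assume "inj_on (\<lambda>x. vec (k - 1) (\<lambda>i. x $ i)) C"
    then have "card C \<le> card (carrier_vec (k - 1) :: 'a vec set)"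
      by (rule card_inj_on_le) (auto intro: linear_code_finite[OF linear_code_carrier_vec])
    then show False
      using card card_field_ge_2[where 'a = 'a] k(1) by (simp add: card_carrier_vec)
  qed
  then obtain x y where xy: "x \<in> C" "y \<in> C" "x \<noteq> y"
    and agree: "vec (k - 1) (\<lambda>i. x $ i) = vec (k - 1) (\<lambda>i. y $ i)"
    by (auto simp: inj_on_def)
  have "{..<k - 1} \<subseteq> {i. i < n \<and> (x - y) $ i = 0}"
  proof
    fix i assume i: "i \<in> {..<k - 1}"
    then have "x $ i = y $ i"
      using arg_cong[OF agree, of "\<lambda>z. z $ i"] by simp
    then show "i \<in> {i. i < n \<and> (x - y) $ i = 0}"
      using i k carr[OF xy(1)] carr[OF xy(2)] by auto
  qed
  then have "card {..<k - 1} \<le> card {i. i < n \<and> (x - y) $ i = 0}"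
    by (rule card_mono[rotated]) simp
  then have "hamming_dist x y = n - k + 1"
    using hamming_dist_eq[OF carr carr, OF xy(1,2)] zeros'[OF xy] k by simp
  then have "n - k + 1 \<in> ?D"
    using xy by force
  then have "min_dist C = n - k + 1"
    unfolding min_dist_def using lower by (intro Min_eqI finite_hamming_dists[OF C]) auto
  then show ?thesis
    unfolding mds_code_def using C dim by simp
qed

section \<open>Rescaling a single coordinate\<close>

definition scale_coord :: "nat \<Rightarrow> nat \<Rightarrow> 'a :: field \<Rightarrow> 'a vec \<Rightarrow> 'a vec" where
  "scale_coord n i b x = vec n (\<lambda>j. if j = i then b * x $ j else x $ j)"

lemma scale_coord_carrier [simp]: "scale_coord n i b x \<in> carrier_vec n"
  by (simp add: scale_coord_def)

lemma scale_coord_index: "j < n \<Longrightarrow> scale_coord n i b x $ j = (if j = i then b * x $ j else x $ j)"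
  by (simp add: scale_coord_def)

lemma inj_on_scale_coord:
  assumes "b \<noteq> 0"
  shows "inj_on (scale_coord n i b) (carrier_vec n)"
proof (rule inj_onI)
  fix x y :: "'a vec"
  assume xy: "x \<in> carrier_vec n" "y \<in> carrier_vec n" and eq: "scale_coord n i b x = scale_coord n i b y"
  have "x $ j = y $ j" if "j < n" for j
    using arg_cong[OF eq, of "\<lambda>z. z $ j"] that assms by (auto simp: scale_coord_index split: if_splits)
  then show "x = y" using xy by auto
qed

lemma linear_code_scale_coord:
  fixes C :: "'a :: field vec set"
  assumes C: "linear_code n C"
  shows "linear_code n (scale_coord n i b ` C)"
proof -
  have carr: "x \<in> carrier_vec n" if "x \<in> C" for x
    using C that by (auto simp: linear_code_iff)
  have 0: "scale_coord n i b (0\<^sub>v n) = 0\<^sub>v n"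
    by (auto simp: scale_coord_def)
  have add: "scale_coord n i b x + scale_coord n i b y = scale_coord n i b (x + y)"
    if "x \<in> C" "y \<in> C" for x y
    using carr[OF that(1)] carr[OF that(2)] by (auto simp: scale_coord_def algebra_simps)
  have smult: "c \<cdot>\<^sub>v scale_coord n i b x = scale_coord n i b (c \<cdot>\<^sub>v x)" if "x \<in> C" for c x
    using carr[OF that] by (auto simp: scale_coord_def)
  show ?thesis
    unfolding linear_code_iff
  proof (intro conjI ballI allI)
    show "scale_coord n i b ` C \<subseteq> carrier_vec n" by auto
    show "0\<^sub>v n \<in> scale_coord n i b ` C"
      using 0 C by (metis imageI linear_code_iff)
  next
    fix x y assume "x \<in> scale_coord n i b ` C" "y \<in> scale_coord n i b ` C"
    then show "x + y \<in> scale_coord n i b ` C"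
      using C by (auto simp: add linear_code_iff)
  next
    fix c x assume "x \<in> scale_coord n i b ` C"
    then show "c \<cdot>\<^sub>v x \<in> scale_coord n i b ` C"
      using C by (auto simp: smult linear_code_iff)
  qed
qed

text \<open>For \<open>b \<noteq> 0\<close> two words differ in the same positions before and after
  rescaling, and injectivity preserves the number of words, hence the dimension.\<close>

lemma mds_code_scale_coord:
  fixes C :: "'a :: {field, finite} vec set"
  assumes C: "mds_code n k C" and b: "b \<noteq> 0"
  shows "mds_code n k (scale_coord n i b ` C)"
proof -
  have lin: "linear_code n C" using C by (simp add: mds_code_def)
  have sub: "C \<subseteq> carrier_vec n" using lin by (simp add: linear_code_iff)
  have inj: "inj_on (scale_coord n i b) C"
    using inj_on_scale_coord[OF b] sub by (rule inj_on_subset)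
  have lin': "linear_code n (scale_coord n i b ` C)"
    by (rule linear_code_scale_coord[OF lin])
  have "card (UNIV :: 'a set) ^ code_dim n (scale_coord n i b ` C) = card (UNIV :: 'a set) ^ code_dim n C"
    using card_linear_code[OF lin] card_linear_code[OF lin'] card_image[OF inj] by simp
  then have dim: "code_dim n (scale_coord n i b ` C) = code_dim n C"
    using card_field_ge_2[where 'a = 'a] by simp
  have dist: "hamming_dist (scale_coord n i b x) (scale_coord n i b y) = hamming_dist x y"
    if "x \<in> C" "y \<in> C" for x y
  proof -
    have "{j. j < n \<and> scale_coord n i b x $ j \<noteq> scale_coord n i b y $ j} = {j. j < n \<and> x $ j \<noteq> y $ j}"
      using b by (auto simp: scale_coord_index split: if_splits)
    moreover have "dim_vec x = n" using that sub by auto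
    ultimately show ?thesis
      by (simp add: hamming_dist_def scale_coord_def)
  qed
  have "{hamming_dist x y | x y. x \<in> scale_coord n i b ` C \<and> y \<in> scale_coord n i b ` C \<and> x \<noteq> y}
      = {hamming_dist x y | x y. x \<in> C \<and> y \<in> C \<and> x \<noteq> y}" (is "?L = ?R")
  proof (intro equalityI subsetI)
    fix d assume "d \<in> ?L"
    then show "d \<in> ?R" using dist by blast
  next
    fix d assume "d \<in> ?R"
    then obtain x y where xy: "x \<in> C" "y \<in> C" "x \<noteq> y" "d = hamming_dist x y" by blast
    then have "scale_coord n i b x \<noteq> scale_coord n i b y"
      using inj by (auto dest: inj_onD)
    then show "d \<in> ?L" using xy dist[OF xy(1,2)] by (metis (mono_tags, lifting) imageI mem_Collect_eq)
  qed
  then show ?thesis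
    using C lin' dim by (simp add: mds_code_def min_dist_def)
qed

section \<open>Conjugation and norm\<close>

locale hermitian_field =
  fixes q :: nat and field_type :: "'a :: {field, finite} itself"
  assumes q: "primepow q" "q > 2" and card_UNIV_eq: "card (UNIV :: 'a set) = q\<^sup>2"
begin

text \<open>The characteristic is a prime dividing \<open>q\<^sup>2\<close>, a power of the prime
  below \<open>q\<close>. So \<open>q\<close> is a power of the characteristic and the freshman's
  dream applies.\<close>

lemma power_q_add: "(x + y :: 'a) ^ q = x ^ q + y ^ q"
  and power_q_sum: "sum f A ^ q = (\<Sum>i\<in>A. (f i :: 'a) ^ q)"
proof -
  obtain p m where p: "prime p" "m > 0" "q = p ^ m"
    using q(1) by (auto simp: primepow_def)
  have dvd: "CHAR('a) dvd q\<^sup>2"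
    using CHAR_dvd_CARD[where 'a = 'a] card_UNIV_eq by simp
  then have "CHAR('a) > 0" using q(2) by (auto intro!: Nat.gr0I)
  then have prime: "prime CHAR('a)"
    by (rule prime_CHAR_semidom)
  have "CHAR('a) dvd p ^ (m * 2)"
    using dvd p(3) by (simp add: power_mult)
  then have "CHAR('a) = p"
    using prime p(1) by (meson prime_dvd_power primes_dvd_imp_eq)
  then have "q = CHAR('a) ^ m" using p by simp
  then show "(x + y :: 'a) ^ q = x ^ q + y ^ q" "sum f A ^ q = (\<Sum>i\<in>A. (f i :: 'a) ^ q)"
    by (auto intro!: freshmans_dream' freshmans_dream_sum' prime)
qed

lemma power_q_0 [simp]: "(0 :: 'a) ^ q = 0"
  using q(2) by (simp add: power_0_left)

lemma power_q_minus: "(- x :: 'a) ^ q = - (x ^ q)"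
  using power_q_add[of x "- x"] by (simp add: minus_unique)

text \<open>Multiplication by \<open>x\<close> permutes the nonzero elements; comparing the products
  over all of them and cancelling gives the claim.\<close>

lemma power_card_minus_1: 
  assumes "(x :: 'a) \<noteq> 0"
  shows "x ^ (q\<^sup>2 - 1) = 1"
proof -
  have "(\<Prod>y\<in>UNIV - {0}. y) = (\<Prod>y\<in>UNIV - {0}. x * y)"
    by (rule prod.reindex_bij_witness[of _ "\<lambda>y. x * y" "\<lambda>y. y / x"]) (use assms in auto)
  also have "\<dots> = x ^ card (UNIV - {0 :: 'a}) * (\<Prod>y\<in>UNIV - {0}. y)"
    by (simp add: prod.distrib)
  also have "card (UNIV - {0 :: 'a}) = q\<^sup>2 - 1"
    by (simp add: card_Diff_singleton card_UNIV_eq)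
  finally show ?thesis by simp
qed

lemma power_q_power_q [simp]: "((x :: 'a) ^ q) ^ q = x"
proof (cases "x = 0")
  case False
  have "(x ^ q) ^ q = x ^ Suc (q\<^sup>2 - 1)"
    using q(2) by (simp add: power2_eq_square flip: power_mult)
  then show ?thesis
    using power_card_minus_1[OF False] by simp
qed simp

text \<open>The fibre is the root set of a nonzero polynomial of degree
  \<open>q + 1\<close>.\<close>

lemma norm_fibre_card:
  fixes c :: 'a
  shows "card {x :: 'a. x ^ (q + 1) = c} \<le> q + 1"
proof -
  let ?p = "Polynomial.monom 1 (q + 1) - [:c:] :: 'a poly"
  have "Polynomial.coeff ?p (q + 1) = 1" by (simp add: coeff_pCons)
  then have "?p \<noteq> 0" by (metis Polynomial.coeff_0 zero_neq_one)
  moreover have "degree ?p \<le> q + 1"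
    by (intro degree_diff_le) (simp_all add: degree_monom_le)
  moreover have "{x :: 'a. x ^ (q + 1) = c} = {x. poly ?p x = 0}"
    by (simp add: poly_monom)
  ultimately show ?thesis
    using card_poly_roots_bound[of ?p] by simp
qed

lemma card_nonzero: "card (UNIV - {0 :: 'a}) = (q - 1) * (q + 1)"
proof -
  have "(q - 1) * (q + 1) = q\<^sup>2 - 1"
    using q(2) by (simp add: power2_eq_square algebra_simps)
  then show ?thesis by (simp add: card_Diff_singleton card_UNIV_eq)
qed

text \<open>Otherwise all \<open>(q - 1) * (q + 1)\<close> nonzero elements would share one norm
  fibre of size at most \<open>q + 1\<close>, forcing \<open>q \<le> 2\<close>.\<close>

lemma exists_norm_neq_1: "\<exists>b :: 'a. b \<noteq> 0 \<and> b ^ (q + 1) \<noteq> 1"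
proof (rule ccontr)
  assume "\<not> ?thesis"
  then have "UNIV - {0} \<subseteq> {x :: 'a. x ^ (q + 1) = 1}" by blast
  then have "card (UNIV - {0 :: 'a}) \<le> card {x :: 'a. x ^ (q + 1) = 1}"
    by (rule card_mono[rotated]) simp
  also have "\<dots> \<le> q + 1" by (rule norm_fibre_card)
  finally have "(q - 1) * (q + 1) \<le> 1 * (q + 1)"
    by (simp only: card_nonzero mult_1)
  then have "q - 1 \<le> 1" by (subst (asm) mult_le_cancel2) simp
  then show False using q(2) by simp
qed

text \<open>Double counting: norms of nonzero elements lie among the at most \<open>q - 1\<close>
  roots of unity of order dividing \<open>q - 1\<close>, while fibres of size at most
  \<open>q + 1\<close> force at least \<open>q - 1\<close> norms.\<close>

lemma norm_surj:
  fixes c :: 'a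
  assumes c: "c ^ q = c" "c \<noteq> 0"
  shows "\<exists>x. x ^ (q + 1) = c"
proof -
  let ?N = "\<lambda>x :: 'a. x ^ (q + 1)"
  \<comment> \<open>These are the nonzero elements of the subfield with \<open>q\<close> elements,
    written so that a root count bounds their number.\<close>
  let ?R = "{x :: 'a. x ^ (q - 1) = 1}"
  have qS: "q = Suc (q - 1)" using q(2) by simp
  have Rq: "x ^ (q - 1) = 1" if "x ^ q = x" "x \<noteq> 0" for x :: 'a
    using that by (subst (asm) (1) qS) simp
  have sub: "?N ` (UNIV - {0}) \<subseteq> ?R"
  proof safe
    fix x :: 'a assume "x \<noteq> 0"
    moreover have "(x ^ (q + 1)) ^ q = x ^ (q + 1)"
    proof -
      have "(x ^ (q + 1)) ^ q = (x ^ q) ^ q * x ^ q"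
        by (simp add: power_mult_distrib)
      then show ?thesis by simp
    qed
    ultimately show "(x ^ (q + 1)) ^ (q - 1) = 1"
      by (intro Rq) auto
  qed
  have "card ?R \<le> q - 1"
  proof -
    let ?p = "Polynomial.monom 1 (q - 1) - [:1:] :: 'a poly"
    have "Polynomial.coeff ?p (q - 1) = 1" using q(2) by (simp add: coeff_pCons split: nat.split)
    then have "?p \<noteq> 0" by (metis Polynomial.coeff_0 zero_neq_one)
    moreover have "degree ?p \<le> q - 1"
      by (intro degree_diff_le) (simp_all add: degree_monom_le)
    moreover have "?R = {x. poly ?p x = 0}"
      by (simp add: poly_monom)
    ultimately show ?thesis
      using card_poly_roots_bound[of ?p] by simp
  qed
  moreover have "(q - 1) * (q + 1) \<le> card (?N ` (UNIV - {0})) * (q + 1)"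
  proof -
    have "card (UNIV - {0 :: 'a}) = (\<Sum>y\<in>?N ` (UNIV - {0}). \<Sum>x\<in>{x \<in> UNIV - {0}. ?N x = y}. 1)"
      by (subst sum.image_gen[of _ _ ?N, symmetric]) simp_all
    also have "\<dots> \<le> (\<Sum>y\<in>?N ` (UNIV - {0}). q + 1)"
    proof (rule sum_mono)
      fix y
      have "card {x \<in> UNIV - {0}. ?N x = y} \<le> card {x. ?N x = y}"
        by (rule card_mono) auto
      then show "(\<Sum>x\<in>{x \<in> UNIV - {0}. ?N x = y}. 1) \<le> q + 1"
        using norm_fibre_card[of y] by simp
    qed
    finally show ?thesis by (simp only: card_nonzero sum_constant of_nat_id)
  qed
  then have "q - 1 \<le> card (?N ` (UNIV - {0}))"
    by (simp only: mult_le_cancel2)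
  ultimately have "?N ` (UNIV - {0}) = ?R"
    using sub by (intro card_seteq) simp_all
  moreover have "c \<in> ?R" using Rq[OF c] by simp
  ultimately have "c \<in> ?N ` (UNIV - {0})" by simp
  then show ?thesis by auto
qed

end

section \<open>The Hermitian hull\<close>

text \<open>The Hermitian form, linear on the left and conjugate-linear on the right. In
  \<open>herm_dual\<close> the codeword is the left argument.\<close>

definition herm :: "nat \<Rightarrow> nat \<Rightarrow> 'a :: field vec \<Rightarrow> 'a vec \<Rightarrow> 'a" where
  "herm q n x y = (\<Sum>i<n. x $ i * (y $ i) ^ q)"

lemma herm_dual_iff: "x \<in> herm_dual q n C \<longleftrightarrow> x \<in> carrier_vec n \<and> (\<forall>y\<in>C. herm q n y x = 0)"
  by (simp add: herm_dual_def herm_def)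

lemma herm_hull_iff: "x \<in> herm_hull q n C \<longleftrightarrow> x \<in> C \<and> x \<in> carrier_vec n \<and> (\<forall>y\<in>C. herm q n y x = 0)"
  by (simp add: herm_hull_def herm_dual_iff)

lemma herm_diff_left:
  "x \<in> carrier_vec n \<Longrightarrow> y \<in> carrier_vec n \<Longrightarrow> herm q n (x - y) z = herm q n x z - herm q n y z"
  by (simp add: herm_def sum_subtractf algebra_simps)

lemma herm_smult_right: "x \<in> carrier_vec n \<Longrightarrow> herm q n z (c \<cdot>\<^sub>v x) = c ^ q * herm q n z x"
  by (simp add: herm_def sum_distrib_left power_mult_distrib algebra_simps)

lemma herm_norm_eq:
  assumes "w \<in> carrier_vec n"
  shows "herm_norm q w = herm q n w w"
  using assms
  by (simp add: herm_norm_def herm_def dagger_def mat_of_row_def scalar_prod_def lessThan_atLeast0)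

context hermitian_field
begin

lemma herm_add_right:
  fixes x y z :: "'a vec"
  shows "x \<in> carrier_vec n \<Longrightarrow> y \<in> carrier_vec n \<Longrightarrow> herm q n z (x + y) = herm q n z x + herm q n z y"
  by (simp add: herm_def sum.distrib power_q_add algebra_simps)

text \<open>Conjugation is additive, multiplicative and an involution. In particular orthogonality
  is symmetric.\<close>

lemma herm_commute: "herm q n y x = (herm q n x (y :: 'a vec)) ^ q"
  by (simp add: herm_def power_q_sum power_mult_distrib mult.commute)

lemma linear_code_herm_hull:
  fixes C :: "'a vec set"
  assumes C: "linear_code n C"
  shows "linear_code n (herm_hull q n C)"
  unfolding linear_code_iff
proof (intro conjI ballI allI)
  show "herm_hull q n C \<subseteq> carrier_vec n" by (auto simp: herm_hull_iff)
  show "0\<^sub>v n \<in> herm_hull q n C"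
    using C by (auto simp: herm_hull_iff linear_code_iff herm_def)
next
  fix x y assume "x \<in> herm_hull q n C" "y \<in> herm_hull q n C"
  then show "x + y \<in> herm_hull q n C"
    using C by (auto simp: herm_hull_iff linear_code_iff herm_add_right)
next
  fix c x assume "x \<in> herm_hull q n C"
  then show "c \<cdot>\<^sub>v x \<in> herm_hull q n C"
    using C by (auto simp: herm_hull_iff linear_code_iff herm_smult_right)
qed

text \<open>Only the summand at \<open>i\<close> changes, acquiring the factor
  \<open>b * b ^ q\<close>.\<close>

lemma herm_scale_coord:
  fixes x y :: "'a vec"
  assumes "i < n"
  shows "herm q n (scale_coord n i b x) (scale_coord n i b y)
    = herm q n x y + (b ^ (q + 1) - 1) * (x $ i * (y $ i) ^ q)"
proof -
  have "herm q n (scale_coord n i b x) (scale_coord n i b y)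
    = (\<Sum>j<n. x $ j * (y $ j) ^ q + (if j = i then (b ^ (q + 1) - 1) * (x $ i * (y $ i) ^ q) else 0))"
    unfolding herm_def by (rule sum.cong) (auto simp: scale_coord_index power_mult_distrib algebra_simps)
  then show ?thesis
    using assms by (simp add: sum.distrib herm_def)
qed

text \<open>Pairing a vector of the new hull with a hull vector \<open>h\<close> of \<open>C\<close> with \<open>h\<^sub>i \<noteq> 0\<close> leaves only the
  contribution of the rescaled coordinate, which must therefore vanish.\<close>

lemma herm_hull_scale_coord:
  fixes C :: "'a vec set"
  assumes C: "linear_code n C" and h: "h \<in> herm_hull q n C" "i < n" "h $ i \<noteq> 0"
    and b: "b ^ (q + 1) \<noteq> 1"
  shows "herm_hull q n (scale_coord n i b ` C) = scale_coord n i b ` {u \<in> herm_hull q n C. u $ i = 0}"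
proof (intro equalityI subsetI)
  fix x assume x: "x \<in> herm_hull q n (scale_coord n i b ` C)"
  then obtain u where u: "u \<in> C" "x = scale_coord n i b u"
    by (auto simp: herm_hull_iff)
  have orth: "herm q n y u + (b ^ (q + 1) - 1) * (y $ i * (u $ i) ^ q) = 0" if "y \<in> C" for y
  proof -
    have "herm q n (scale_coord n i b y) x = 0"
      using x that by (simp add: herm_hull_iff)
    then show ?thesis unfolding u(2) herm_scale_coord[OF h(2)] .
  qed
  have "herm q n u h = 0" "h \<in> C" using h(1) u(1) by (auto simp: herm_hull_iff)
  then have "u $ i = 0"
    using orth[of h] h(3) b herm_commute[of n h u] by simp
  moreover have "u \<in> carrier_vec n" using C u(1) by (auto simp: linear_code_iff)
  ultimately show "x \<in> scale_coord n i b ` {u \<in> herm_hull q n C. u $ i = 0}"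
    using u orth by (simp add: herm_hull_iff)
next
  fix x assume "x \<in> scale_coord n i b ` {u \<in> herm_hull q n C. u $ i = 0}"
  then show "x \<in> herm_hull q n (scale_coord n i b ` C)"
    using h(2) by (auto simp: herm_hull_iff herm_scale_coord)
qed

text \<open>The new hull corresponds to the old hull vectors vanishing at a suitable
  \<open>i\<close>. This kernel of a coordinate functional has codimension at most one, and it is
  proper by the choice of \<open>i\<close>.\<close>

lemma mds_code_decrease_hull:
  fixes C :: "'a vec set"
  assumes C: "mds_code n k C" and dim: "code_dim n (herm_hull q n C) = Suc l"
  shows "\<exists>D :: 'a vec set. mds_code n k D \<and> code_dim n (herm_hull q n D) = l"
proof -
  let ?Q = "card (UNIV :: 'a set)" and ?H = "herm_hull q n C"
  have lin: "linear_code n C" using C by (simp add: mds_code_def)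
  note linH = linear_code_herm_hull[OF lin]
  have Q: "?Q \<ge> 2" by (rule card_field_ge_2)
  have cardH: "card ?H = ?Q ^ Suc l"
    using card_linear_code[OF linH] dim by simp
  have sub: "?H \<subseteq> carrier_vec n" using linH by (simp add: linear_code_iff)
  \<comment> \<open>A hull of positive dimension has more than one element, hence a nonzero vector
    and a coordinate in its support.\<close>
  have "\<not> ?H \<subseteq> {0\<^sub>v n}"
  proof
    assume "?H \<subseteq> {0\<^sub>v n}"
    then have "card ?H \<le> 1" using card_mono[of "{0\<^sub>v n}" ?H] by simp
    moreover have "1 < ?Q ^ Suc l" using Q by (intro one_less_power) auto
    ultimately show False using cardH by simp
  qed
  then obtain h where h: "h \<in> ?H" "h \<noteq> 0\<^sub>v n" by blast
  then obtain i where i: "i < n" "h $ i \<noteq> 0"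
    using sub by (auto simp: vec_eq_iff)
  obtain b :: 'a where b: "b \<noteq> 0" "b ^ (q + 1) \<noteq> 1" using exists_norm_neq_1 by blast
  let ?D = "scale_coord n i b ` C" and ?K = "{u \<in> ?H. u $ i = 0}"
  have mds: "mds_code n k ?D" by (rule mds_code_scale_coord[OF C b(1)])
  have "inj_on (scale_coord n i b) ?K"
    using inj_on_scale_coord[OF b(1)] by (rule inj_on_subset) (use sub in auto)
  then have "card (herm_hull q n ?D) = card ?K"
    by (simp add: herm_hull_scale_coord[OF lin h(1) i b(2)] card_image)
  moreover have linD: "linear_code n (herm_hull q n ?D)"
    using mds linear_code_herm_hull by (auto simp: mds_code_def)
  ultimately have cardK: "card ?K = ?Q ^ code_dim n (herm_hull q n ?D)"
    using card_linear_code by metis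
  have "?Q ^ Suc l \<le> ?Q * card ?K"
    unfolding cardH[symmetric]
    by (rule card_linear_functional_kernel[OF linH]) (use sub i in auto)
  then have "l \<le> code_dim n (herm_hull q n ?D)"
    using Q by (simp add: cardK)
  \<comment> \<open>Strict, because \<open>h\<close> belongs to \<open>?H\<close> but not to
    \<open>?K\<close>.\<close>
  moreover have "card ?K < card ?H"
    by (rule psubset_card_mono) (use linear_code_finite[OF linH] h i in auto)
  then have "code_dim n (herm_hull q n ?D) < Suc l"
    unfolding cardK cardH by (rule power_less_imp_less_exp[rotated]) (use Q in simp)
  ultimately show ?thesis using mds by auto
qed

text \<open>Repeated lowering, by downward induction from the hull dimension of \<open>C\<close>. A
  lower bound on the size of the hull is enough, so its exact dimension never has to be
  found.\<close>

lemma mds_code_exists_hull_dim: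
  fixes C :: "'a vec set"
  assumes C: "mds_code n k C" and s: "card (UNIV :: 'a set) ^ s \<le> card (herm_hull q n C)"
  shows "\<exists>D :: 'a vec set. mds_code n k D \<and> code_dim n (herm_hull q n D) = s"
proof -
  have "\<exists>D :: 'a vec set. mds_code n k D \<and> code_dim n (herm_hull q n D) = s"
    if "s \<le> t" "\<exists>D :: 'a vec set. mds_code n k D \<and> code_dim n (herm_hull q n D) = t" for t
    using that by (induction rule: inc_induct) (use mds_code_decrease_hull in blast)+
  moreover have "linear_code n (herm_hull q n C)"
    using C linear_code_herm_hull by (simp add: mds_code_def)
  ultimately show ?thesis
    using s C by (auto simp: card_ge_power_code_dim_iff)
qed

end

section \<open>Extended codes\<close>

text \<open>For \<open>c\<close> in the row space of a matrix, these words form the row space of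
  that matrix with a zero column appended and the row \<open>(w, \<alpha>)\<close> added. Keeping
  the pair \<open>(c, t)\<close> as parameters makes counting direct.\<close>

definition ext_word :: "nat \<Rightarrow> 'a :: field vec \<Rightarrow> 'a \<Rightarrow> 'a vec \<Rightarrow> 'a \<Rightarrow> 'a vec" where
  "ext_word n w \<alpha> c t = vec (n + 1) (\<lambda>j. if j < n then c $ j + t * w $ j else t * \<alpha>)"

definition ext_code :: "nat \<Rightarrow> 'a :: field vec \<Rightarrow> 'a \<Rightarrow> 'a vec set \<Rightarrow> 'a vec set" where
  "ext_code n w \<alpha> C = (\<lambda>(c, t). ext_word n w \<alpha> c t) ` (C \<times> UNIV)"

lemma ext_word_carrier [simp]: "ext_word n w \<alpha> c t \<in> carrier_vec (n + 1)"
  by (simp add: ext_word_def)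

lemma ext_word_index:
  "j < n \<Longrightarrow> ext_word n w \<alpha> c t $ j = c $ j + t * w $ j"
  "ext_word n w \<alpha> c t $ n = t * \<alpha>"
  by (simp_all add: ext_word_def)

lemma ext_word_add:
  "c \<in> carrier_vec n \<Longrightarrow> d \<in> carrier_vec n \<Longrightarrow>
    ext_word n w \<alpha> c t + ext_word n w \<alpha> d u = ext_word n w \<alpha> (c + d) (t + u)"
  by (auto simp: ext_word_def algebra_simps)

lemma ext_word_smult:
  "c \<in> carrier_vec n \<Longrightarrow> a \<cdot>\<^sub>v ext_word n w \<alpha> c t = ext_word n w \<alpha> (a \<cdot>\<^sub>v c) (a * t)"
  by (auto simp: ext_word_def algebra_simps)

text \<open>The last coordinate determines \<open>t\<close> because \<alpha> is nonzero; the others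
  then determine \<open>c\<close>.\<close>

lemma inj_on_ext_word:
  assumes "\<alpha> \<noteq> 0"
  shows "inj_on (\<lambda>(c, t). ext_word n w \<alpha> c t) (carrier_vec n \<times> UNIV)"
proof (rule inj_onI, clarify)
  fix c d :: "'a vec" and t u
  assume cd: "c \<in> carrier_vec n" "d \<in> carrier_vec n" and eq: "ext_word n w \<alpha> c t = ext_word n w \<alpha> d u"
  have "t * \<alpha> = u * \<alpha>"
    using arg_cong[OF eq, of "\<lambda>z. z $ n"] by (simp add: ext_word_index)
  then have tu: "t = u" using assms by simp
  have "c $ j = d $ j" if "j < n" for j
    using arg_cong[OF eq, of "\<lambda>z. z $ j"] that tu by (simp add: ext_word_index)
  then show "c = d \<and> t = u" using cd tu by auto
qed

lemma linear_code_ext_code: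
  fixes C :: "'a :: field vec set"
  assumes C: "linear_code n C"
  shows "linear_code (n + 1) (ext_code n w \<alpha> C)"
proof -
  have carr: "x \<in> carrier_vec n" if "x \<in> C" for x
    using C that by (auto simp: linear_code_iff)
  have 0: "0\<^sub>v (n + 1) = ext_word n w \<alpha> (0\<^sub>v n) 0"
    by (auto simp: ext_word_def)
  show ?thesis
    unfolding linear_code_iff
  proof (intro conjI ballI allI)
    show "ext_code n w \<alpha> C \<subseteq> carrier_vec (n + 1)" by (auto simp: ext_code_def ext_word_def)
    show "0\<^sub>v (n + 1) \<in> ext_code n w \<alpha> C"
      using C unfolding 0 ext_code_def linear_code_iff by blast
  next
    fix x y assume "x \<in> ext_code n w \<alpha> C" "y \<in> ext_code n w \<alpha> C"
    then obtain c d t u where *: "c \<in> C" "d \<in> C" "x = ext_word n w \<alpha> c t" "y = ext_word n w \<alpha> d u"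
      by (auto simp: ext_code_def)
    then have "x + y = ext_word n w \<alpha> (c + d) (t + u)" "c + d \<in> C"
      using C carr by (auto simp: ext_word_add linear_code_iff)
    then show "x + y \<in> ext_code n w \<alpha> C" by (force simp: ext_code_def)
  next
    fix a x assume "x \<in> ext_code n w \<alpha> C"
    then obtain c t where *: "c \<in> C" "x = ext_word n w \<alpha> c t"
      by (auto simp: ext_code_def)
    then have "a \<cdot>\<^sub>v x = ext_word n w \<alpha> (a \<cdot>\<^sub>v c) (a * t)" "a \<cdot>\<^sub>v c \<in> C"
      using C carr by (auto simp: ext_word_smult linear_code_iff)
    then show "a \<cdot>\<^sub>v x \<in> ext_code n w \<alpha> C" by (force simp: ext_code_def)
  qed
qed

text \<open>A word with \<open>t = 0\<close> gains one zero, at the last position, over the at most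
  \<open>k - 1\<close> of \<open>c\<close>. A word with \<open>t \<noteq> 0\<close> is nonzero
  there, so only \<open>zeros_w\<close> counts.\<close>

lemma mds_code_ext_code:
  fixes C :: "'a :: {field, finite} vec set"
  assumes C: "linear_code n C" "card C = card (UNIV :: 'a set) ^ k"
    and k: "1 \<le> k" "k \<le> n" and \<alpha>: "\<alpha> \<noteq> 0"
    and zeros: "\<And>c. c \<in> C \<Longrightarrow> c \<noteq> 0\<^sub>v n \<Longrightarrow> card {j. j < n \<and> c $ j = 0} \<le> k - 1"
    and zeros_w: "\<And>c t. c \<in> C \<Longrightarrow> t \<noteq> 0 \<Longrightarrow> card {j. j < n \<and> c $ j + t * w $ j = 0} \<le> k"
  shows "mds_code (n + 1) (k + 1) (ext_code n w \<alpha> C)"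
proof (rule mds_codeI)
  show "linear_code (n + 1) (ext_code n w \<alpha> C)" by (rule linear_code_ext_code[OF C(1)])
  have "inj_on (\<lambda>(c, t). ext_word n w \<alpha> c t) (C \<times> UNIV)"
    using inj_on_ext_word[OF \<alpha>] by (rule inj_on_subset) (use C(1) in \<open>auto simp: linear_code_iff\<close>)
  then show "card (ext_code n w \<alpha> C) = card (UNIV :: 'a set) ^ (k + 1)"
    by (simp add: ext_code_def card_image card_cartesian_product C(2))
next
  fix x assume x: "x \<in> ext_code n w \<alpha> C" "x \<noteq> 0\<^sub>v (n + 1)"
  then obtain c t where c: "c \<in> C" "x = ext_word n w \<alpha> c t" by (auto simp: ext_code_def)
  show "card {j. j < n + 1 \<and> x $ j = 0} \<le> k + 1 - 1"
  proof (cases "t = 0")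
    case True
    have "c \<noteq> 0\<^sub>v n" using x(2) True unfolding c(2) by (auto simp: ext_word_def)
    have "{j. j < n + 1 \<and> x $ j = 0} \<subseteq> insert n {j. j < n \<and> c $ j = 0}"
      using True by (auto simp: c(2) ext_word_index less_Suc_eq)
    then have "card {j. j < n + 1 \<and> x $ j = 0} \<le> card (insert n {j. j < n \<and> c $ j = 0})"
      by (rule card_mono[rotated]) simp
    also have "\<dots> \<le> Suc (card {j. j < n \<and> c $ j = 0})"
      by (rule card_insert_le_m1) auto
    finally show ?thesis
      using zeros[OF c(1) \<open>c \<noteq> 0\<^sub>v n\<close>] k by simp
  next
    case False
    have "{j. j < n + 1 \<and> x $ j = 0} = {j. j < n \<and> c $ j + t * w $ j = 0}"
      using False \<alpha> by (auto simp: c(2) ext_word_index less_Suc_eq)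
    then show ?thesis using zeros_w[OF c(1) False] by simp
  qed
qed (use k in auto)

context hermitian_field
begin

text \<open>Sorted by the parameter \<open>u\<close> of the left word: orthogonality to the whole
  extended code follows once the part free of \<open>u\<close> and the coefficient of
  \<open>u\<close> both vanish.\<close>

lemma herm_ext_word:
  fixes w c d :: "'a vec"
  shows "herm q (n + 1) (ext_word n w \<alpha> d u) (ext_word n w \<alpha> c t)
    = herm q n d c + t ^ q * herm q n d w + u * (herm q n w c + t ^ q * (herm q n w w + \<alpha> ^ (q + 1)))"
proof -
  have "herm q (n + 1) (ext_word n w \<alpha> d u) (ext_word n w \<alpha> c t)
    = (\<Sum>j<n. (d $ j + u * w $ j) * (c $ j + t * w $ j) ^ q) + (u * \<alpha>) * (t * \<alpha>) ^ q"
    by (simp add: herm_def ext_word_index)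
  also have "(\<Sum>j<n. (d $ j + u * w $ j) * (c $ j + t * w $ j) ^ q)
    = (\<Sum>j<n. d $ j * (c $ j) ^ q + t ^ q * (d $ j * (w $ j) ^ q)
        + u * (w $ j * (c $ j) ^ q) + u * t ^ q * (w $ j * (w $ j) ^ q))"
    by (rule sum.cong) (simp_all add: power_q_add power_mult_distrib algebra_simps)
  also have "\<dots> = herm q n d c + t ^ q * herm q n d w + u * herm q n w c + u * t ^ q * herm q n w w"
    by (simp add: herm_def sum.distrib sum_distrib_left)
  finally show ?thesis
    by (simp add: power_mult_distrib algebra_simps)
qed

text \<open>\<open>orth\<close> and \<open>orth_w\<close> are these two vanishing conditions, so
  \<open>S\<close> injects into the hull of the extended code.\<close>

lemma card_le_card_herm_hull_ext_code:
  fixes C :: "'a vec set"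
  assumes C: "linear_code n C" and \<alpha>: "\<alpha> \<noteq> 0" and S: "S \<subseteq> C \<times> UNIV"
    and orth: "\<And>c t d. (c, t) \<in> S \<Longrightarrow> d \<in> C \<Longrightarrow> herm q n d c + t ^ q * herm q n d w = 0"
    and orth_w: "\<And>c t. (c, t) \<in> S \<Longrightarrow> herm q n w c + t ^ q * (herm q n w w + \<alpha> ^ (q + 1)) = 0"
  shows "card S \<le> card (herm_hull q (n + 1) (ext_code n w \<alpha> C))"
proof (rule card_inj_on_le)
  show "inj_on (\<lambda>(c, t). ext_word n w \<alpha> c t) S"
    using inj_on_ext_word[OF \<alpha>] by (rule inj_on_subset) (use C S in \<open>auto simp: linear_code_iff\<close>)
  show "(\<lambda>(c, t). ext_word n w \<alpha> c t) ` S \<subseteq> herm_hull q (n + 1) (ext_code n w \<alpha> C)"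
  proof clarify
    fix c t assume ct: "(c, t) \<in> S"
    have "ext_word n w \<alpha> c t \<in> ext_code n w \<alpha> C"
      using ct S by (force simp: ext_code_def)
    moreover have "herm q (n + 1) y (ext_word n w \<alpha> c t) = 0" if y: "y \<in> ext_code n w \<alpha> C" for y
    proof -
      obtain d u where d: "d \<in> C" "y = ext_word n w \<alpha> d u"
        using y by (auto simp: ext_code_def)
      show ?thesis
        unfolding d(2) herm_ext_word orth[OF ct d(1)] orth_w[OF ct] by simp
    qed
    ultimately show "ext_word n w \<alpha> c t \<in> herm_hull q (n + 1) (ext_code n w \<alpha> C)"
      unfolding herm_hull_iff by (intro conjI ballI ext_word_carrier)
  qed
  show "finite (herm_hull q (n + 1) (ext_code n w \<alpha> C))"
    by (rule linear_code_finite[OF linear_code_herm_hull[OF linear_code_ext_code[OF C]]])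
qed

end

section \<open>Generalized Reed-Solomon codes\<close>

text \<open>The message \<open>y\<close> times the generator matrix; the entries of \<open>y\<close>
  are the coefficients of the evaluated polynomial.\<close>

definition grs_word :: "nat \<Rightarrow> nat \<Rightarrow> 'a :: field vec \<Rightarrow> 'a vec \<Rightarrow> 'a vec \<Rightarrow> 'a vec" where
  "grs_word n k a v y = vec n (\<lambda>j. \<Sum>i<k. y $ i * grs_row n a v (int i) $ j)"

lemma grs_row_carrier [simp]: "grs_row n a v i \<in> carrier_vec n"
  by (simp add: grs_row_def)

lemma grs_word_eq:
  "grs_word n k a v y = vec n (\<lambda>j. v $ j * poly (\<Sum>i<k. Polynomial.monom (y $ i) i) (a $ j))"
  by (auto simp: grs_word_def grs_row_def poly_sum poly_monom sum_distrib_left algebra_simps)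

text \<open>Distinct evaluation points send zero positions injectively to roots.\<close>

lemma card_poly_zeros_le_degree:
  fixes p :: "'a :: field poly"
  assumes "p \<noteq> 0" "inj_on (($) a) {..<n}"
  shows "card {j. j < n \<and> poly p (a $ j) = 0} \<le> Polynomial.degree p"
proof -
  have "card {j. j < n \<and> poly p (a $ j) = 0} \<le> card {x. poly p x = 0}"
    by (rule card_inj_on_le[of "($) a"])
       (use assms in \<open>auto intro: inj_on_subset poly_roots_finite\<close>)
  also have "\<dots> \<le> Polynomial.degree p"
    by (rule card_poly_roots_bound[OF assms(1)])
  finally show ?thesis .
qed

lemma degree_sum_monom_le: "Polynomial.degree (\<Sum>i<k. Polynomial.monom (y i) i) \<le> k - 1"
  by (rule degree_sum_le) (auto intro: order_trans[OF degree_monom_le])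

lemma coeff_sum_monom: "Polynomial.coeff (\<Sum>i<k. Polynomial.monom (y i) i) j = (if j < k then y j else 0)"
  by (simp add: Polynomial.coeff_sum Polynomial.coeff_monom)

lemma GRS_eq_image_grs_word:
  fixes a v :: "'a :: field vec"
  assumes k: "1 \<le> k"
  shows "GRS n k a v = grs_word n k a v ` carrier_vec k"
proof (intro equalityI subsetI)
  fix x assume "x \<in> GRS n k a v"
  then obtain f where f: "Polynomial.degree f \<le> k - 1" "x = vec n (\<lambda>j. v $ j * poly f (a $ j))"
    by (auto simp: GRS_def)
  let ?y = "vec k (Polynomial.coeff f)"
  have f_eq: "(\<Sum>i<k. Polynomial.monom (?y $ i) i) = f"
  proof (rule poly_eqI)
    fix j
    show "Polynomial.coeff (\<Sum>i<k. Polynomial.monom (?y $ i) i) j = Polynomial.coeff f j"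
      \<comment> \<open>Since \<open>1 \<le> k\<close>, every index \<open>j \<ge> k\<close> exceeds
        the degree bound \<open>k - 1\<close>.\<close>
      unfolding coeff_sum_monom using f(1) k by (auto intro: Polynomial.coeff_eq_0)
  qed
  have "x = grs_word n k a v ?y"
    unfolding grs_word_eq f_eq by (rule f(2))
  then show "x \<in> grs_word n k a v ` carrier_vec k" by auto
next
  fix x assume "x \<in> grs_word n k a v ` carrier_vec k"
  then obtain y where "x = grs_word n k a v y" by blast
  then have "x = vec n (\<lambda>j. v $ j * poly (\<Sum>i<k. Polynomial.monom (y $ i) i) (a $ j))"
    by (simp add: grs_word_eq)
  then show "x \<in> GRS n k a v"
    unfolding GRS_def using degree_sum_monom_le by blast
qed

lemma linear_code_GRS: "linear_code n (GRS n k a v)"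
  unfolding linear_code_iff
proof (intro conjI ballI allI)
  show "GRS n k a v \<subseteq> carrier_vec n" by (auto simp: GRS_def)
  show "0\<^sub>v n \<in> GRS n k a v"
    unfolding GRS_def by (rule CollectI, rule exI[of _ 0]) auto
next
  fix x y assume "x \<in> GRS n k a v" "y \<in> GRS n k a v"
  then obtain f g where f: "Polynomial.degree f \<le> k - 1" "x = vec n (\<lambda>j. v $ j * poly f (a $ j))"
    and g: "Polynomial.degree g \<le> k - 1" "y = vec n (\<lambda>j. v $ j * poly g (a $ j))"
    by (auto simp: GRS_def)
  then show "x + y \<in> GRS n k a v"
    unfolding GRS_def
    by (intro CollectI exI[of _ "f + g"]) (auto simp: algebra_simps intro: Polynomial.degree_add_le)
next
  fix c x assume "x \<in> GRS n k a v"
  then obtain f where f: "Polynomial.degree f \<le> k - 1" "x = vec n (\<lambda>j. v $ j * poly f (a $ j))"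
    by (auto simp: GRS_def)
  then show "c \<cdot>\<^sub>v x \<in> GRS n k a v"
    unfolding GRS_def
    by (intro CollectI exI[of _ "Polynomial.smult c f"])
       (auto intro: order_trans[OF Polynomial.degree_smult_le])
qed

text \<open>Equal words give a difference polynomial of degree below \<open>n\<close> with
  \<open>n\<close> distinct roots, hence zero.\<close>

lemma inj_on_grs_word:
  fixes a v :: "'a :: field vec"
  assumes a: "inj_on (($) a) {..<n}" and v: "\<forall>i<n. v $ i \<noteq> 0" and k: "1 \<le> k" "k \<le> n"
  shows "inj_on (grs_word n k a v) (carrier_vec k)"
proof (rule inj_onI)
  fix y z :: "'a vec" assume yz: "y \<in> carrier_vec k" "z \<in> carrier_vec k"
    and eq: "grs_word n k a v y = grs_word n k a v z"
  let ?P = "\<lambda>y :: 'a vec. \<Sum>i<k. Polynomial.monom (y $ i) i"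
  let ?p = "?P y - ?P z"
  have "poly ?p (a $ j) = 0" if "j < n" for j
    using arg_cong[OF eq, of "\<lambda>x. x $ j"] that v by (simp add: grs_word_eq)
  then have zeros: "{j. j < n \<and> poly ?p (a $ j) = 0} = {..<n}" by auto
  have "?p = 0"
  proof (rule ccontr)
    assume "?p \<noteq> 0"
    then have "n \<le> Polynomial.degree ?p"
      using card_poly_zeros_le_degree[OF _ a, of ?p] unfolding zeros by simp
    also have "\<dots> \<le> k - 1"
      by (intro degree_diff_le degree_sum_monom_le)
    finally show False using k by simp
  qed
  then have "Polynomial.coeff (?P y) i = Polynomial.coeff (?P z) i" for i by simp
  then have "y $ i = z $ i" if "i < k" for i
    using that unfolding coeff_sum_monom by (metis (full_types))
  then show "y = z" using yz by auto
qed

lemma card_GRS: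
  fixes a v :: "'a :: {field, finite} vec"
  assumes "inj_on (($) a) {..<n}" "\<forall>i<n. v $ i \<noteq> 0" "1 \<le> k" "k \<le> n"
  shows "card (GRS n k a v) = card (UNIV :: 'a set) ^ k"
  using assms by (simp add: GRS_eq_image_grs_word card_image inj_on_grs_word card_carrier_vec)

lemma card_zeros_GRS:
  fixes a v :: "'a :: field vec"
  assumes a: "inj_on (($) a) {..<n}" and v: "\<forall>i<n. v $ i \<noteq> 0"
    and c: "c \<in> GRS n k a v" "c \<noteq> 0\<^sub>v n"
  shows "card {j. j < n \<and> c $ j = 0} \<le> k - 1"
proof -
  obtain f where f: "Polynomial.degree f \<le> k - 1" "c = vec n (\<lambda>j. v $ j * poly f (a $ j))"
    using c(1) by (auto simp: GRS_def)
  have "f \<noteq> 0" using c(2) f(2) by auto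
  moreover have "{j. j < n \<and> c $ j = 0} = {j. j < n \<and> poly f (a $ j) = 0}"
    using v by (auto simp: f(2))
  ultimately show ?thesis
    using card_poly_zeros_le_degree[OF _ a, of f] f(1) by simp
qed

text \<open>Up to nonzero column multipliers, the word is the evaluation of a nonzero polynomial of
  degree at most \<open>k\<close>.\<close>

lemma card_zeros_GRS_add_grs_row:
  fixes a v :: "'a :: field vec"
  assumes a: "inj_on (($) a) {..<n}" and v: "\<forall>i<n. v $ i \<noteq> 0" and k: "1 \<le> k"
    and w: "w = grs_row n a v (int k) \<or> (\<forall>i<n. a $ i \<noteq> 0) \<and> w = grs_row n a v (- 1)"
    and c: "c \<in> GRS n k a v" and t: "t \<noteq> 0"
  shows "card {j. j < n \<and> c $ j + t * w $ j = 0} \<le> k"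
proof -
  obtain f where f: "Polynomial.degree f \<le> k - 1" "c = vec n (\<lambda>j. v $ j * poly f (a $ j))"
    using c by (auto simp: GRS_def)
  have "\<exists>p. p \<noteq> 0 \<and> Polynomial.degree p \<le> k \<and> (\<forall>j<n. c $ j + t * w $ j = 0 \<longleftrightarrow> poly p (a $ j) = 0)"
    using w
  proof
    assume w: "w = grs_row n a v (int k)"
    let ?p = "f + Polynomial.monom t k"
    have "Polynomial.coeff ?p k = t"
      using f(1) k by (simp add: Polynomial.coeff_eq_0)
    then have "?p \<noteq> 0" using t by (metis Polynomial.coeff_0)
    moreover have "Polynomial.degree ?p \<le> k"
      using f(1) by (intro Polynomial.degree_add_le) (auto simp: degree_monom_le)
    moreover have "c $ j + t * w $ j = v $ j * poly ?p (a $ j)" if "j < n" for j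
      using that by (simp add: f(2) w grs_row_def poly_monom algebra_simps)
    ultimately show ?thesis using v by (intro exI[of _ ?p]) auto
  next
    assume w: "(\<forall>i<n. a $ i \<noteq> 0) \<and> w = grs_row n a v (- 1)"
    \<comment> \<open>Pulling the factor \<open>v $ j / a $ j\<close> out of entry \<open>j\<close>
      leaves the polynomial \<open>t + x f\<close>, with constant term
      \<open>t \<noteq> 0\<close>.\<close>
    let ?p = "pCons t f"
    have "?p \<noteq> 0" using t by simp
    moreover have "Polynomial.degree ?p \<le> k"
      using f(1) k order_trans[OF degree_pCons_le[of t f]] by simp
    moreover have "c $ j + t * w $ j = v $ j / a $ j * poly ?p (a $ j)" if "j < n" for j
      using that w by (simp add: f(2) grs_row_def power_int_minus field_simps)
    ultimately show ?thesis using v w by (intro exI[of _ ?p]) auto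
  qed
  then obtain p where p: "p \<noteq> 0" "Polynomial.degree p \<le> k"
    "\<forall>j<n. c $ j + t * w $ j = 0 \<longleftrightarrow> poly p (a $ j) = 0" by blast
  then have "{j. j < n \<and> c $ j + t * w $ j = 0} = {j. j < n \<and> poly p (a $ j) = 0}" by auto
  then show ?thesis
    using card_poly_zeros_le_degree[OF p(1) a] p(2) by simp
qed

section \<open>The generator matrix and the Gram matrix of the extended code\<close>

lemma grs_gen_mat_carrier [simp]: "grs_gen_mat n k a v \<in> carrier_mat k n"
  using mat_of_rows_carrier(1)[of n "map (\<lambda>i. grs_row n a v (int i)) [0..<k]"]
  by (simp add: grs_gen_mat_def)

lemma grs_gen_mat_index:
  "i < k \<Longrightarrow> j < n \<Longrightarrow> grs_gen_mat n k a v $$ (i, j) = grs_row n a v (int i) $ j"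
  by (simp add: grs_gen_mat_def mat_of_rows_index)

lemma herm_grs_word:
  "herm q n (grs_word n k a v x) z = (\<Sum>i<k. x $ i * herm q n (grs_row n a v (int i)) z)"
proof -
  have "herm q n (grs_word n k a v x) z
    = (\<Sum>j<n. \<Sum>i<k. x $ i * (grs_row n a v (int i) $ j * (z $ j) ^ q))"
    by (simp add: herm_def grs_word_def sum_distrib_right mult.assoc)
  also have "\<dots> = (\<Sum>i<k. x $ i * herm q n (grs_row n a v (int i)) z)"
    by (subst sum.swap) (simp add: herm_def sum_distrib_left)
  finally show ?thesis .
qed

lemma mult_mat_vec_index_sum:
  "A \<in> carrier_mat m n \<Longrightarrow> x \<in> carrier_vec n \<Longrightarrow> i < m \<Longrightarrow> (A *\<^sub>v x) $ i = (\<Sum>j<n. A $$ (i, j) * x $ j)"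
  by (auto simp: scalar_prod_def lessThan_atLeast0 intro!: sum.cong)

context hermitian_field
begin

text \<open>\<open>G S G\<^sup>\<dagger>\<close> is, up to a nonzero factor, the Schur complement of the corner entry in the Gram
  matrix of the extended code.\<close>

lemma grs_gram_mult_vec:
  fixes a v w y :: "'a vec" and N :: 'a and n k :: nat
  defines "G \<equiv> grs_gen_mat n k a v"
    and "S \<equiv> N \<cdot>\<^sub>m 1\<^sub>m n - dagger q (mat_of_row w) * mat_of_row w"
    and "c \<equiv> grs_word n k a v (vec k (\<lambda>i. (y $ i) ^ q))"
  assumes w: "w \<in> carrier_vec n" and y: "y \<in> carrier_vec k" and i: "i < k"
  shows "(G * S * dagger q G *\<^sub>v y) $ i
    = N * herm q n (grs_row n a v (int i)) c - herm q n w c * herm q n (grs_row n a v (int i)) w"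
proof -
  let ?g = "grs_row n a v (int i)"
  have G: "G \<in> carrier_mat k n" by (simp add: G_def)
  have S: "S \<in> carrier_mat n n" using w by (simp add: S_def dagger_def mat_of_row_def carrier_matI)
  have dG: "dagger q G \<in> carrier_mat n k" using G by (simp add: dagger_def)
  define z where "z = dagger q G *\<^sub>v y"
  have z: "z \<in> carrier_vec n" using dG y by (simp add: z_def)
  \<comment> \<open>The message of \<open>c\<close> is the conjugate of \<open>y\<close>, so
    conjugating \<open>c\<close> restores \<open>y\<close> and yields the product of
    \<open>dagger q G\<close> with \<open>y\<close>.\<close>
  have z_index: "z $ j = (c $ j) ^ q" if j: "j < n" for j
  proof -
    have "z $ j = (\<Sum>m<k. (grs_row n a v (int m) $ j) ^ q * y $ m)"
      unfolding z_def mult_mat_vec_index_sum[OF dG y j] using G j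
      by (intro sum.cong) (simp_all add: dagger_def G_def grs_gen_mat_index carrier_matD[OF grs_gen_mat_carrier])
    then show ?thesis
      using j by (simp add: c_def grs_word_def power_q_sum power_mult_distrib mult.commute)
  qed
  \<comment> \<open>The subtracted matrix has rank at most one: it sends the conjugate of
    \<open>c\<close> to the conjugate of \<open>w\<close> scaled by
    \<open>herm q n w c\<close>.\<close>
  have Sz_index: "(S *\<^sub>v z) $ j = N * (c $ j) ^ q - (w $ j) ^ q * herm q n w c" if j: "j < n" for j
  proof -
    have "(S *\<^sub>v z) $ j = (\<Sum>m<n. (if j = m then N * (c $ m) ^ q else 0) - (w $ j) ^ q * (w $ m * (c $ m) ^ q))"
      unfolding mult_mat_vec_index_sum[OF S z j] using w j
      by (intro sum.cong) (auto simp: S_def dagger_def mat_of_row_def scalar_prod_def z_index algebra_simps)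
    then show ?thesis
      using j by (simp add: sum_subtractf herm_def sum_distrib_left)
  qed
  have Sz: "S *\<^sub>v z \<in> carrier_vec n" using S z by simp
  have eq: "G * S * dagger q G *\<^sub>v y = G *\<^sub>v (S *\<^sub>v z)"
    using G S dG y z by (simp add: z_def assoc_mult_mat_vec[of _ k n _ k] assoc_mult_mat_vec[of _ k n _ n])
  have "(G * S * dagger q G *\<^sub>v y) $ i = (\<Sum>j<n. N * (?g $ j * (c $ j) ^ q) - herm q n w c * (?g $ j * (w $ j) ^ q))"
    unfolding eq mult_mat_vec_index_sum[OF G Sz i]
    using i by (intro sum.cong) (simp_all add: G_def grs_gen_mat_index Sz_index algebra_simps)
  then show ?thesis
    by (simp add: sum_subtractf herm_def sum_distrib_left)
qed

end

theorem proposition3: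
  fixes q n k l :: nat
    and a v w :: "'a :: {field, finite} vec"
    and C :: "'a vec set"
    and G :: "'a mat"
  assumes "primepow q" and "q > 2" and "card (UNIV :: 'a set) = q\<^sup>2"
    and "a \<in> carrier_vec n" and "\<forall>i<n. \<forall>j<n. i \<noteq> j \<longrightarrow> a $ i \<noteq> a $ j"
    and "v \<in> carrier_vec n" and "\<forall>i<n. v $ i \<noteq> 0"
    and "1 \<le> k" and "k \<le> n"
    and "C = GRS n k a v"
    and "G = grs_gen_mat n k a v"
    and "code_dim n (herm_hull q n C) = l" and "l \<le> k"
    and "w = grs_row n a v (int k) \<or>
         (n < q\<^sup>2 \<and> (\<forall>i<n. a $ i \<noteq> 0) \<and> w = grs_row n a v (- 1))"
  shows
    "(w \<in> herm_dual q n C \<and> herm_norm q w \<noteq> 0 \<longrightarrow>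
        (\<forall>s\<le>l + 1. \<exists>D :: 'a vec set.
           mds_code (n + 1) (k + 1) D \<and> code_dim (n + 1) (herm_hull q (n + 1) D) = s)) \<and>
     (w \<notin> herm_dual q n (herm_hull q n C) \<longrightarrow>
        (\<forall>s. int s \<le> int l - 1 \<longrightarrow> (\<exists>D :: 'a vec set.
           mds_code (n + 1) (k + 1) D \<and> code_dim (n + 1) (herm_hull q (n + 1) D) = s))) \<and>
     (w \<in> herm_dual q n (herm_hull q n C) \<longrightarrow>
        (\<forall>s\<le>l. \<exists>D :: 'a vec set.
           mds_code (n + 1) (k + 1) D \<and> code_dim (n + 1) (herm_hull q (n + 1) D) = s)) \<and>
     (\<forall>lam \<in> Fq q - {0}. lam + herm_norm q w \<noteq> 0 \<longrightarrow>
        (let S = (lam + herm_norm q w) \<cdot>\<^sub>m 1\<^sub>m n - dagger q (mat_of_row w) * mat_of_row w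
         in \<forall>s. int s \<le> int k - int (vec_space.rank k (G * S * dagger q G)) \<longrightarrow>
              (\<exists>D :: 'a vec set.
                 mds_code (n + 1) (k + 1) D \<and> code_dim (n + 1) (herm_hull q (n + 1) D) = s)))"
proof -
  interpret hermitian_field q "TYPE('a)"
    using assms(1-3) by unfold_locales
  let ?Q = "card (UNIV :: 'a set)" and ?H = "herm_hull q n C"
  have a: "inj_on (($) a) {..<n}"
    using assms(5) by (auto simp: inj_on_def)
  note v = assms(7) and k = assms(8,9) and C_eq = assms(10) and G_eq = assms(11)
  have w: "w \<in> carrier_vec n" using assms(14) by auto
  have linC: "linear_code n C" unfolding C_eq by (rule linear_code_GRS)
  have carr: "x \<in> carrier_vec n" if "x \<in> C" for x
    using linC that by (auto simp: linear_code_iff)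
  note linH = linear_code_herm_hull[OF linC]
  have cardH: "card ?H = ?Q ^ l"
    using card_linear_code[OF linH] assms(12) by simp
  have HC: "x \<in> C" "d \<in> C \<Longrightarrow> herm q n d x = 0" if "x \<in> ?H" for x d
    using that by (auto simp: herm_hull_iff)
  have mds: "mds_code (n + 1) (k + 1) (ext_code n w \<alpha> C)" if "\<alpha> \<noteq> 0" for \<alpha>
    unfolding C_eq
  proof (rule mds_code_ext_code[OF linear_code_GRS card_GRS[OF a v k] k that])
    show "card {j. j < n \<and> c $ j = 0} \<le> k - 1" if "c \<in> GRS n k a v" "c \<noteq> 0\<^sub>v n" for c
      by (rule card_zeros_GRS[OF a v that])
    show "card {j. j < n \<and> c $ j + t * w $ j = 0} \<le> k" if "c \<in> GRS n k a v" "t \<noteq> 0" for c t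
      by (rule card_zeros_GRS_add_grs_row[OF a v k(1) _ that]) (use assms(14) in blast)
  qed
  \<comment> \<open>Common engine of all four claims: it remains to choose \<alpha> and a large
    enough set \<open>S\<close> of pairs giving hull words.\<close>
  have exists_code: "\<exists>D :: 'a vec set. mds_code (n + 1) (k + 1) D \<and> code_dim (n + 1) (herm_hull q (n + 1) D) = s"
    if \<alpha>: "\<alpha> \<noteq> 0" and S: "S \<subseteq> C \<times> UNIV"
      and orth: "\<And>c t d. (c, t) \<in> S \<Longrightarrow> d \<in> C \<Longrightarrow> herm q n d c + t ^ q * herm q n d w = 0"
      and orth_w: "\<And>c t. (c, t) \<in> S \<Longrightarrow> herm q n w c + t ^ q * (herm q n w w + \<alpha> ^ (q + 1)) = 0"
      and r: "?Q ^ r \<le> card S" and s: "s \<le> r"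
    for \<alpha> S r s
  proof (rule mds_code_exists_hull_dim[OF mds[OF \<alpha>]])
    have "?Q ^ s \<le> ?Q ^ r"
      using card_field_ge_2[where 'a = 'a] s by (intro power_increasing) auto
    also note r
    also have "card S \<le> card (herm_hull q (n + 1) (ext_code n w \<alpha> C))"
      by (rule card_le_card_herm_hull_ext_code[OF linC \<alpha> S orth orth_w])
    finally show "?Q ^ s \<le> card (herm_hull q (n + 1) (ext_code n w \<alpha> C))" .
  qed
  have norm_w: "herm_norm q w = herm q n w w" by (rule herm_norm_eq[OF w])
  \<comment> \<open>The norm of \<open>w\<close> is fixed by conjugation, so it lies in the domain
    of \<open>norm_surj\<close>.\<close>
  have norm_w_q: "herm q n w w ^ q = herm q n w w"
    using herm_commute[of n w w] by simp
  show ?thesis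
  proof (intro conjI impI allI ballI)
    fix s assume *: "w \<in> herm_dual q n C \<and> herm_norm q w \<noteq> 0" and s: "s \<le> l + 1"
    have dual: "herm q n d w = 0" if "d \<in> C" for d
      using * that by (simp add: herm_dual_iff)
    have dual': "herm q n w d = 0" if "d \<in> C" for d
      using dual[OF that] herm_commute[of n w d] by simp
    \<comment> \<open>This choice makes the added row \<open>(w, \<alpha>)\<close> orthogonal to
      itself. As it is also orthogonal to \<open>C\<close>, it contributes one dimension to the
      hull.\<close>
    obtain \<alpha> where \<alpha>: "\<alpha> ^ (q + 1) = - herm q n w w"
      using norm_surj[of "- herm q n w w"] * norm_w_q by (auto simp: norm_w power_q_minus)
    have norm_0: "herm q n w w + \<alpha> * \<alpha> ^ q = 0"
      using \<alpha> by simp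
    have "\<alpha> \<noteq> 0"
    proof
      assume "\<alpha> = 0"
      then show False using \<alpha> * by (simp add: norm_w)
    qed
    then show "\<exists>D :: 'a vec set. mds_code (n + 1) (k + 1) D \<and> code_dim (n + 1) (herm_hull q (n + 1) D) = s"
      by (rule exists_code[where S = "?H \<times> UNIV" and r = "l + 1"])
         (use HC dual dual' s in \<open>auto simp: card_cartesian_product cardH norm_0\<close>)
  next
    fix s assume s: "int s \<le> int l - 1"
    \<comment> \<open>The hull words orthogonal to \<open>w\<close>: appending a zero to them, that
      is \<open>t = 0\<close>, keeps them in the hull.\<close>
    let ?K = "{c \<in> ?H. herm q n c w = 0}"
    have "?Q ^ l \<le> ?Q * card ?K"
      unfolding cardH[symmetric]
      by (rule card_linear_functional_kernel[OF linH]) (auto intro!: herm_diff_left carr HC)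
    \<comment> \<open>The bound on \<open>s\<close> is over the integers and \<open>s\<close> is
      natural, so \<open>l \<ge> 1\<close> and \<open>l - 1\<close> is not truncated.\<close>
    moreover have "?Q ^ l = ?Q * ?Q ^ (l - 1)"
      using s by (cases l) auto
    ultimately have "?Q ^ (l - 1) \<le> card ?K"
      using card_field_ge_2[where 'a = 'a] by simp
    moreover have "herm q n w c = 0" if "c \<in> ?K" for c
      using that herm_commute[of n w c] by simp
    ultimately show "\<exists>D :: 'a vec set. mds_code (n + 1) (k + 1) D \<and> code_dim (n + 1) (herm_hull q (n + 1) D) = s"
      by (intro exists_code[where S = "?K \<times> {0}" and r = "l - 1" and \<alpha> = 1])
         (use HC s in \<open>auto simp: card_cartesian_product\<close>)
  next
    fix s assume *: "w \<in> herm_dual q n ?H" and s: "s \<le> l"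
    \<comment> \<open>All of \<open>?H\<close> is now orthogonal to \<open>w\<close>, so no
      dimension is lost with \<open>t = 0\<close>. Any nonzero \<alpha> serves; it is taken to be
      \<open>1\<close>.\<close>
    have "herm q n w c = 0" if "c \<in> ?H" for c
      using that * herm_commute[of n w c] by (simp add: herm_dual_iff)
    then show "\<exists>D :: 'a vec set. mds_code (n + 1) (k + 1) D \<and> code_dim (n + 1) (herm_hull q (n + 1) D) = s"
      by (intro exists_code[where S = "?H \<times> {0}" and r = l and \<alpha> = 1])
         (use HC s in \<open>auto simp: card_cartesian_product cardH\<close>)
  next
    fix lam :: 'a assume lam: "lam \<in> Fq q - {0}" and nz: "lam + herm_norm q w \<noteq> 0"
    define N where "N = lam + herm_norm q w"
    define M where "M = G * (N \<cdot>\<^sub>m 1\<^sub>m n - dagger q (mat_of_row w) * mat_of_row w) * dagger q G"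
    \<comment> \<open>The conjugated message is the one for which \<open>dagger q G\<close> applied
      to \<open>y\<close> is the conjugate of \<open>c y\<close>, as in
      \<open>grs_gram_mult_vec\<close>.\<close>
    define c where "c y = grs_word n k a v (vec k (\<lambda>i. (y $ i) ^ q))" for y
    have M: "M \<in> carrier_mat k k"
      unfolding M_def G_eq by (rule carrier_matI) (simp_all add: dagger_def carrier_matD[OF grs_gen_mat_carrier])
    have N: "N \<noteq> 0" "N ^ q = N" "N = herm q n w w + lam"
      using nz lam norm_w_q by (auto simp: N_def norm_w power_q_add Fq_def)
    obtain \<alpha> where \<alpha>: "\<alpha> ^ (q + 1) = lam"
      using norm_surj[of lam] lam by (auto simp: Fq_def)
    have "\<alpha> \<noteq> 0"
    proof
      assume "\<alpha> = 0"
      then show False using \<alpha> lam by simp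
    qed
    have c: "c y \<in> C" for y
      unfolding c_def C_eq GRS_eq_image_grs_word[OF k(1)] by (rule imageI) simp
    have inj_c: "inj_on c (carrier_vec k)"
    proof (rule inj_onI)
      fix x y :: "'a vec" assume xy: "x \<in> carrier_vec k" "y \<in> carrier_vec k" "c x = c y"
      have eq: "vec k (\<lambda>i. (x $ i) ^ q) = vec k (\<lambda>i. (y $ i) ^ q)"
        by (rule inj_onD[OF inj_on_grs_word[OF a v k]]) (use xy(3) in \<open>simp_all add: c_def\<close>)
      have "(x $ i) ^ q = (y $ i) ^ q" if "i < k" for i
        using arg_cong[OF eq, of "\<lambda>z. z $ i"] that by simp
      then have "x $ i = y $ i" if "i < k" for i
        using that power_q_power_q by metis
      then show "x = y" using xy by auto
    qed
    \<comment> \<open>Each coordinate of \<open>M *\<^sub>v y = 0\<^sub>v k\<close> gives the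
      relation for one row of \<open>G\<close>; linearity on the left extends it to all of
      \<open>C\<close>.\<close>
    have kernel: "N * herm q n d (c y) = herm q n w (c y) * herm q n d w"
      if y: "y \<in> mat_kernel M" and d: "d \<in> C" for d y
    proof -
      obtain x where x: "d = grs_word n k a v x"
        using d unfolding C_eq GRS_eq_image_grs_word[OF k(1)] by blast
      have y': "y \<in> carrier_vec k" "M *\<^sub>v y = 0\<^sub>v k"
        using mat_kernelD[OF M y] by auto
      have row: "N * herm q n (grs_row n a v (int i)) (c y) = herm q n w (c y) * herm q n (grs_row n a v (int i)) w"
        if "i < k" for i
        using grs_gram_mult_vec[OF w y'(1) that, where N = N and a = a and v = v] y'(2) that
        by (simp add: M_def G_eq c_def)
      then show ?thesis
        unfolding x herm_grs_word sum_distrib_left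
        by (intro sum.cong refl) (use row in \<open>simp add: mult.left_commute\<close>)
    qed
    \<comment> \<open>Here \<open>t ^ q = - herm q n w (c y)\<close> and \<open>N ^ q = N\<close>.
      Thus \<open>orth\<close> becomes the relation \<open>kernel\<close>, and \<open>orth_w\<close>
      cancels because \<open>herm q n w w + \<alpha> ^ (q + 1)\<close> equals
      \<open>N\<close>.\<close>
    define S where "S = (\<lambda>y. (N \<cdot>\<^sub>v c y, - herm q n (c y) w)) ` mat_kernel M"
    have tau: "(- herm q n (c y) w) ^ q = - herm q n w (c y)" for y
      by (simp add: power_q_minus herm_commute[of n w "c y"])
    have "inj_on (\<lambda>y. (N \<cdot>\<^sub>v c y, - herm q n (c y) w)) (mat_kernel M)"
    proof (rule inj_onI)
      fix x y assume xy: "x \<in> mat_kernel M" "y \<in> mat_kernel M"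
        "(N \<cdot>\<^sub>v c x, - herm q n (c x) w) = (N \<cdot>\<^sub>v c y, - herm q n (c y) w)"
      then have eq: "N \<cdot>\<^sub>v c x = N \<cdot>\<^sub>v c y" by simp
      have "c x $ j = c y $ j" if "j < n" for j
        using arg_cong[OF eq, of "\<lambda>z. z $ j"] that N(1) carr[OF c[of x]] carr[OF c[of y]] by simp
      then have "c x = c y"
        using carr[OF c[of x]] carr[OF c[of y]] by auto
      then show "x = y"
        using inj_onD[OF inj_c] mat_kernelD(1)[OF M] xy by blast
    qed
    then have card_S: "card S = card (mat_kernel M)"
      by (simp add: S_def card_image)
    have result: "\<exists>D :: 'a vec set. mds_code (n + 1) (k + 1) D \<and> code_dim (n + 1) (herm_hull q (n + 1) D) = s"
      if s: "int s \<le> int k - int (vec_space.rank k M)" for s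
    proof (rule exists_code[OF \<open>\<alpha> \<noteq> 0\<close>])
      show "S \<subseteq> C \<times> UNIV"
        using c linC by (auto simp: S_def linear_code_iff)
      show "herm q n d x + t ^ q * herm q n d w = 0" if "(x, t) \<in> S" "d \<in> C" for x t d
        using that kernel carr[OF c] by (auto simp: S_def herm_smult_right tau N(2))
      show "herm q n w x + t ^ q * (herm q n w w + \<alpha> ^ (q + 1)) = 0" if "(x, t) \<in> S" for x t
        using that carr[OF c] unfolding \<alpha> by (auto simp: S_def herm_smult_right tau N(2) N(3)[symmetric])
      \<comment> \<open>The integer bound on the natural number \<open>s\<close> forces the rank to
        be at most \<open>k\<close>, so the subtraction in the exponent is exact.\<close>
      have "?Q ^ k = ?Q ^ vec_space.rank k M * ?Q ^ (k - vec_space.rank k M)"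
        using s by (simp flip: power_add)
      then have "?Q ^ (k - vec_space.rank k M) = card (mat_kernel M)"
        using card_mat_kernel[OF M] card_field_ge_2[where 'a = 'a] by simp
      then show "?Q ^ (k - vec_space.rank k M) \<le> card S"
        by (simp add: card_S)
      show "s \<le> k - vec_space.rank k M" using s by simp
    qed
    show "let S = (lam + herm_norm q w) \<cdot>\<^sub>m 1\<^sub>m n - dagger q (mat_of_row w) * mat_of_row w
         in \<forall>s. int s \<le> int k - int (vec_space.rank k (G * S * dagger q G)) \<longrightarrow>
              (\<exists>D :: 'a vec set.
                 mds_code (n + 1) (k + 1) D \<and> code_dim (n + 1) (herm_hull q (n + 1) D) = s)"
      unfolding Let_def N_def[symmetric] M_def[symmetric] using result by blast
  qed
qed

end
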